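(* Let $\lambda,\mu,\pi$ be partitions with $|\lambda|=|\mu|+|\pi|$, let $\iota=|\lambda|+\lambda_1$, and let $\tilde\lambda=(3\iota-|\lambda|,\lambda_1,\lambda_2,\dots)$, $\tilde\mu=(3\iota-|\mu|,\mu_1,\mu_2,\dots)$, $\tilde\pi=(3\iota-|\pi|,\pi_1,\pi_2,\dots)$, so that $|\tilde\lambda|=|\tilde\mu|=|\tilde\pi|=3\iota$. Then $t^{\tilde\lambda}_{\tilde\mu,\tilde\pi}>0$.
   Context: For a partition $\alpha$, $\alpha^T$ is the vector of its column lengths (transpose partition). For finite $P\subseteq\mathbb{N}^3$ the marginals are $(x_P,y_P,z_P)$ with $x_P(i)$ the number of points of $P$ with $x$-coordinate $i$, etc. For partitions $\lambda,\mu,\pi$ of equal size, $t^\lambda_{\mu,\pi}$ is the number of finite $P\subseteq\mathbb{N}^3$ with marginals $(\lambda^T,\mu^T,\pi^T)$. *)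

theory Defs
  imports Main
begin

text \<open>
  A partition is a weakly decreasing, eventually vanishing sequence of naturals, so trailing zeros
  are not distinguished. Everything is indexed from 0: the largest part, usually written with
  index 1, is \<open>\<alpha> 0\<close>, and points have coordinates in \<open>{0, 1, 2, ...}\<close>.
\<close>

definition is_partition :: "(nat \<Rightarrow> nat) \<Rightarrow> bool" where
  "is_partition \<alpha> \<longleftrightarrow> antimono \<alpha> \<and> finite {i. \<alpha> i \<noteq> 0}"

definition psize :: "(nat \<Rightarrow> nat) \<Rightarrow> nat" where
  "psize \<alpha> = (\<Sum>i | \<alpha> i \<noteq> 0. \<alpha> i)"

text \<open>Column \<open>j\<close> of the Young diagram has a box in row \<open>i\<close> iff \<open>j < \<alpha> i\<close>.\<close>

definition transp :: "(nat \<Rightarrow> nat) \<Rightarrow> (nat \<Rightarrow> nat)" where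
  "transp \<alpha> j = card {i. j < \<alpha> i}"

definition x_marginal :: "(nat \<times> nat \<times> nat) set \<Rightarrow> (nat \<Rightarrow> nat)" where
  "x_marginal P i = card {(x, y, z) \<in> P. x = i}"

definition y_marginal :: "(nat \<times> nat \<times> nat) set \<Rightarrow> (nat \<Rightarrow> nat)" where
  "y_marginal P i = card {(x, y, z) \<in> P. y = i}"

definition z_marginal :: "(nat \<times> nat \<times> nat) set \<Rightarrow> (nat \<Rightarrow> nat)" where
  "z_marginal P i = card {(x, y, z) \<in> P. z = i}"

text \<open>
  \<open>t_num \<lambda> \<mu> \<pi>\<close> is the number with upper index \<open>\<lambda>\<close> and lower indices \<open>\<mu>, \<pi>\<close>; it is meant only
  for partitions of equal size.
\<close>

definition t_num :: "(nat \<Rightarrow> nat) \<Rightarrow> (nat \<Rightarrow> nat) \<Rightarrow> (nat \<Rightarrow> nat) \<Rightarrow> nat" where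
  "t_num lam mu pi = card {P. finite P \<and> x_marginal P = transp lam
     \<and> y_marginal P = transp mu \<and> z_marginal P = transp pi}"

text \<open>
  \<open>pad N \<alpha> = (N - |\<alpha>|, \<alpha>\<^sub>1, \<alpha>\<^sub>2, ...)\<close>, with truncated subtraction; it is meant for \<open>|\<alpha>| \<le> N\<close>.
\<close>

definition pad :: "nat \<Rightarrow> (nat \<Rightarrow> nat) \<Rightarrow> (nat \<Rightarrow> nat)" where
  "pad N \<alpha> i = (case i of 0 \<Rightarrow> N - psize \<alpha> | Suc j \<Rightarrow> \<alpha> j)"

end

theory Submission
  imports Defs
begin

text \<open>
  The columns of a padded partition have length 1 except for those with index below the first part
  of the original partition. The number of boxes in the longer columns of \<open>tlam\<close> is at most
  \<open>|lam| + lam 0\<close>, and likewise for \<open>tmu\<close>; together this does not exceed \<open>3 * \<iota>\<close>. Hence, labelling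
  the \<open>3 * \<iota>\<close> points, the labels can be given x- and y-coordinates with the right multiplicities in
  such a way that no label has both a repeated x-coordinate and a repeated y-coordinate. Then the
  pairs (x, y) are pairwise distinct, and the z-coordinates can be assigned arbitrarily.
\<close>

lemma card_Sigma_psize:
  assumes "finite {j. c j \<noteq> 0}"
  shows "card (Sigma {j. c j \<noteq> 0} (\<lambda>j. {..<c j})) = psize c"
  using assms by (simp add: psize_def)

text \<open>A labelling with fibre sizes \<open>c\<close> is a bijection from \<open>K\<close> to
  the boxes of a diagram with column lengths \<open>c\<close>, followed by the column index. The set
  \<open>A\<close> is large enough to supply all labels for columns with more than one box, so a
  label outside \<open>A\<close> can be made alone in its column.\<close>

lemma exists_labelling:
  fixes c :: "nat \<Rightarrow> nat"
  assumes fin: "finite {j. c j \<noteq> 0}" and K: "finite K" "card K = psize c"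
    and A: "A \<subseteq> K" "(\<Sum>j | 1 < c j. c j) \<le> card A"
  obtains X where "\<And>j. card {k \<in> K. X k = j} = c j"
    "\<And>k l. k \<in> K - A \<Longrightarrow> l \<in> K \<Longrightarrow> X k = X l \<Longrightarrow> k = l"
proof -
  define T where "T = Sigma {j. c j \<noteq> 0} (\<lambda>j. {..<c j})"
  define U where "U = Sigma {j. 1 < c j} (\<lambda>j. {..<c j})"
  have finT: "finite T" and cT: "card T = card K"
    using fin K card_Sigma_psize[OF fin] by (auto simp: T_def)
  have finF: "finite {j. 1 < c j}"
    by (rule finite_subset[OF _ fin]) auto
  have UT: "U \<subseteq> T" by (auto simp: T_def U_def)
  have "card U \<le> card A" using A(2) finF by (simp add: U_def)
  \<comment> \<open>\<open>A\<close> may be larger than \<open>U\<close>. Exactly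
    \<open>card U\<close> labels are cut out of it, so that bijections from \<open>B\<close> to
    \<open>U\<close> and between the complements can be glued.\<close>
  then obtain B where B: "B \<subseteq> A" "card B = card U"
    by (meson obtain_subset_with_card_n)
  have finB: "finite B" using B A K finite_subset by metis
  have finU: "finite U" using UT finT finite_subset by blast
  obtain f where f: "bij_betw f B U"
    using finite_same_card_bij[OF finB finU B(2)] by blast
  have "card (K - B) = card (T - U)"
    using B A UT cT finB finU by (simp add: card_Diff_subset)
  then obtain g where g: "bij_betw g (K - B) (T - U)"
    using finite_same_card_bij[of "K - B" "T - U"] K finT by blast
  define h where "h k = (if k \<in> B then f k else g k)" for k
  have hB: "bij_betw h B U"
    using f by (rule bij_betw_cong[THEN iffD1, rotated]) (simp add: h_def)
  have hK: "bij_betw h (K - B) (T - U)"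
    using g by (rule bij_betw_cong[THEN iffD1, rotated]) (simp add: h_def)
  have "bij_betw h (B \<union> (K - B)) (U \<union> (T - U))"
    by (rule bij_betw_combine[OF hB hK]) auto
  then have h: "bij_betw h K T"
    using B A UT by (simp add: Un_absorb1)
  show thesis
  proof
    fix j
    have "bij_betw h {k \<in> K. fst (h k) = j} {t \<in> T. fst t = j}"
      using h by (auto simp: bij_betw_def inj_on_def)
    then have "card {k \<in> K. fst (h k) = j} = card {t \<in> T. fst t = j}"
      by (rule bij_betw_same_card)
    also have "{t \<in> T. fst t = j} = Pair j ` {..<c j}"
      by (auto simp: T_def)
    also have "card \<dots> = c j" by (simp add: card_image inj_on_def)
    finally show "card {k \<in> K. (fst \<circ> h) k = j} = c j" by simp
  next
    fix k l assume k: "k \<in> K - A" and l: "l \<in> K" and eq: "(fst \<circ> h) k = (fst \<circ> h) l"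
    have "h k \<in> T - U" using hK k B by (auto simp: bij_betw_def)
    moreover have "h l \<in> T" using h l by (auto simp: bij_betw_def)
    \<comment> \<open>The column of \<open>h k\<close> has a single box, so both second components
      are 0.\<close>
    ultimately have "h k = h l"
      using eq by (auto simp: T_def U_def prod_eq_iff)
    then show "k = l" using h k l by (auto simp: bij_betw_def inj_on_def)
  qed
qed

text \<open>With projections in place of patterns, one fibre count serves all three
  marginals.\<close>

lemma marginal_eq_card:
  "x_marginal P j = card {q \<in> P. fst q = j}"
  "y_marginal P j = card {q \<in> P. fst (snd q) = j}"
  "z_marginal P j = card {q \<in> P. snd (snd q) = j}"
  unfolding x_marginal_def y_marginal_def z_marginal_def
  by (rule arg_cong[where f=card]; auto)+

lemma exists_point_set:
  fixes x y z :: "nat \<Rightarrow> nat"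
  assumes fin: "finite {j. x j \<noteq> 0}" "finite {j. y j \<noteq> 0}" "finite {j. z j \<noteq> 0}"
    and size: "psize y = psize x" "psize z = psize x"
    and le: "(\<Sum>j | 1 < x j. x j) + (\<Sum>j | 1 < y j. y j) \<le> psize x"
  obtains P where "finite P" "x_marginal P = x" "y_marginal P = y" "z_marginal P = z"
proof -
  define K where "K = {..<psize x}"
  define A where "A = {..<(\<Sum>j | 1 < x j. x j)}"
  have K: "finite K" "card K = psize x" by (auto simp: K_def)
  have A: "A \<subseteq> K" "card (K - A) = psize x - (\<Sum>j | 1 < x j. x j)"
    using le by (auto simp: A_def K_def card_Diff_subset)
  obtain X where X: "\<And>j. card {k \<in> K. X k = j} = x j"
      "\<And>k l. k \<in> K - A \<Longrightarrow> l \<in> K \<Longrightarrow> X k = X l \<Longrightarrow> k = l"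
    using exists_labelling[OF fin(1) K A(1)] by (auto simp: A_def)
  \<comment> \<open>The complement of \<open>A\<close> now takes the role of \<open>A\<close>:
    repeated y-coordinates occur only outside \<open>A\<close>, repeated x-coordinates only
    inside.\<close>
  obtain Y where Y: "\<And>j. card {k \<in> K. Y k = j} = y j"
      "\<And>k l. k \<in> K - (K - A) \<Longrightarrow> l \<in> K \<Longrightarrow> Y k = Y l \<Longrightarrow> k = l"
  proof (rule exists_labelling[OF fin(2) K(1)])
    show "card K = psize y" "K - A \<subseteq> K" using K size by auto
    show "(\<Sum>j | 1 < y j. y j) \<le> card (K - A)" using A le by simp
  qed (rule that)
  have "(\<Sum>j | 1 < z j. z j) \<le> psize z"
    unfolding psize_def using fin(3) by (intro sum_mono2) auto
  \<comment> \<open>All of \<open>K\<close> is allowed for repetitions, so only the fibre sizes of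
    \<open>Z\<close> matter.\<close>
  then obtain Z where Z: "\<And>j. card {k \<in> K. Z k = j} = z j"
    using exists_labelling[OF fin(3) K(1), of K] K size by auto
  define p where "p k = (X k, Y k, Z k)" for k
  \<comment> \<open>Of two distinct labels with equal x- and y-coordinates, each would lie both in
    \<open>A\<close> and outside it.\<close>
  have inj: "inj_on p K"
    using X(2) Y(2) by (auto simp: inj_on_def p_def)
  have fib: "card {q \<in> p ` K. u q = j} = card {k \<in> K. u (p k) = j}"
    for u :: "nat \<times> nat \<times> nat \<Rightarrow> nat" and j
  proof -
    have "{q \<in> p ` K. u q = j} = p ` {k \<in> K. u (p k) = j}" by auto
    then show ?thesis
      using inj by (simp add: card_image inj_on_subset)
  qed
  show thesis
  proof
    show "finite (p ` K)" using K by simp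
    show "x_marginal (p ` K) = x" "y_marginal (p ` K) = y" "z_marginal (p ` K) = z"
      using X(1) Y(1) Z unfolding fun_eq_iff marginal_eq_card fib by (simp_all add: p_def)
  qed
qed

text \<open>Each coordinate of a point of \<open>P\<close> has a nonzero marginal, which confines
  \<open>P\<close> to a fixed finite box. Finiteness is essential for positivity of
  \<open>t_num\<close>, since \<open>card\<close> of an infinite set is 0.\<close>

lemma finite_marginal_sets:
  assumes fin: "finite {j. x j \<noteq> 0}" "finite {j. y j \<noteq> 0}" "finite {j. z j \<noteq> 0}"
  shows "finite {P. finite P \<and> x_marginal P = x \<and> y_marginal P = y \<and> z_marginal P = z}"
proof (rule finite_subset)
  show "finite (Pow ({j. x j \<noteq> 0} \<times> {j. y j \<noteq> 0} \<times> {j. z j \<noteq> 0}))"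
    using fin by simp
  have nz: "card {q \<in> P. u q = u p} \<noteq> 0" if "finite P" "p \<in> P"
    for P :: "(nat \<times> nat \<times> nat) set" and p and u :: "nat \<times> nat \<times> nat \<Rightarrow> nat"
    using that by (auto simp: card_eq_0_iff simp del: split_paired_Ex split_paired_All)
  show "{P. finite P \<and> x_marginal P = x \<and> y_marginal P = y \<and> z_marginal P = z}
    \<subseteq> Pow ({j. x j \<noteq> 0} \<times> {j. y j \<noteq> 0} \<times> {j. z j \<noteq> 0})"
  proof clarsimp
    fix P :: "(nat \<times> nat \<times> nat) set" and a b c
    assume P: "finite P" "(a, b, c) \<in> P"
    show "0 < x_marginal P a \<and> 0 < y_marginal P b \<and> 0 < z_marginal P c"
      using nz[OF P, of fst] nz[OF P, of "\<lambda>q. fst (snd q)"] nz[OF P, of "\<lambda>q. snd (snd q)"]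
      by (simp add: marginal_eq_card)
  qed
qed

lemma t_num_pos:
  assumes "finite {j. transp lam j \<noteq> 0}" "finite {j. transp mu j \<noteq> 0}" "finite {j. transp pi j \<noteq> 0}"
    and "psize (transp mu) = psize (transp lam)" "psize (transp pi) = psize (transp lam)"
    and "(\<Sum>j | 1 < transp lam j. transp lam j) + (\<Sum>j | 1 < transp mu j. transp mu j)
      \<le> psize (transp lam)"
  shows "t_num lam mu pi > 0"
proof -
  obtain P where "finite P" "x_marginal P = transp lam" "y_marginal P = transp mu"
    "z_marginal P = transp pi"
    using exists_point_set[OF assms] by blast
  then show ?thesis
    using finite_marginal_sets[OF assms(1-3)] by (auto simp: t_num_def card_gt_0_iff)
qed

text \<open>Row 0 is the longest, so it meets every nonempty column. Finiteness of the columns keeps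
  \<open>card\<close> from returning 0 on a nonempty one.\<close>

lemma support_transp:
  assumes "is_partition \<alpha>"
  shows "{j. transp \<alpha> j \<noteq> 0} = {..<\<alpha> 0}" "finite {i. j < \<alpha> i}"
proof -
  have *: "finite {i. j < \<alpha> i}" for j
    by (rule finite_subset[of _ "{i. \<alpha> i \<noteq> 0}"]) (use assms in \<open>auto simp: is_partition_def\<close>)
  have "\<alpha> i \<le> \<alpha> 0" for i
    using assms by (auto simp: is_partition_def antimono_def)
  then show "{j. transp \<alpha> j \<noteq> 0} = {..<\<alpha> 0}"
    using * by (auto simp: transp_def card_eq_0_iff intro: less_le_trans)
  show "finite {i. j < \<alpha> i}" by (rule *)
qed

text \<open>Double counting: the boxes are summed by rows and by columns.\<close>

lemma psize_transp:
  assumes "is_partition \<alpha>"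
  shows "psize (transp \<alpha>) = psize \<alpha>"
proof -
  let ?S = "Sigma {i. \<alpha> i \<noteq> 0} (\<lambda>i. {..<\<alpha> i})"
  let ?T = "Sigma {j. transp \<alpha> j \<noteq> 0} (\<lambda>j. {i. j < \<alpha> i})"
  have "?T = prod.swap ` ?S"
    using support_transp(2)[OF assms] by (force simp: transp_def card_eq_0_iff image_iff)
  then have "card ?T = card ?S"
    by (simp add: card_image)
  moreover have "card ?S = psize \<alpha>"
    using assms by (simp add: psize_def is_partition_def)
  moreover have "card ?T = psize (transp \<alpha>)"
    using support_transp[OF assms] by (simp add: psize_def transp_def)
  ultimately show ?thesis by simp
qed

lemma first_part_le_psize:
  assumes "is_partition \<alpha>"
  shows "\<alpha> 0 \<le> psize \<alpha>"
proof (cases "\<alpha> 0 = 0")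
  case False
  then show ?thesis
    using assms by (auto simp: is_partition_def psize_def intro!: member_le_sum)
qed simp

lemma support_pad: "{i. pad N \<alpha> i \<noteq> 0} \<subseteq> insert 0 (Suc ` {i. \<alpha> i \<noteq> 0})"
proof
  fix i assume "i \<in> {i. pad N \<alpha> i \<noteq> 0}"
  then show "i \<in> insert 0 (Suc ` {i. \<alpha> i \<noteq> 0})"
    by (cases i) (auto simp: pad_def)
qed

text \<open>The bound says that the new first row is at least as long as the old one.\<close>

lemma is_partition_pad:
  assumes "is_partition \<alpha>" "psize \<alpha> + \<alpha> 0 \<le> N"
  shows "is_partition (pad N \<alpha>)"
proof -
  have "antimono (pad N \<alpha>)"
    unfolding antimono_iff_le_Suc
    using assms by (auto simp: pad_def is_partition_def antimono_def split: nat.split)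
  moreover have "{i. pad N \<alpha> i \<noteq> 0} \<subseteq> insert 0 (Suc ` {i. \<alpha> i \<noteq> 0})"
    by (rule support_pad)
  ultimately show ?thesis
    using assms(1) by (auto simp: is_partition_def intro: finite_subset)
qed

lemma psize_pad:
  assumes "is_partition \<alpha>" "psize \<alpha> \<le> N"
  shows "psize (pad N \<alpha>) = N"
proof -
  let ?S = "{i. \<alpha> i \<noteq> 0}"
  have fin: "finite ?S" using assms by (simp add: is_partition_def)
  have "psize (pad N \<alpha>) = (\<Sum>i\<in>insert 0 (Suc ` ?S). pad N \<alpha> i)"
    unfolding psize_def using fin support_pad
    by (intro sum.mono_neutral_left) auto
  also have "\<dots> = (N - psize \<alpha>) + psize \<alpha>"
    using fin by (simp add: pad_def sum.reindex psize_def)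
  finally show ?thesis using assms by simp
qed

text \<open>The new row on top adds one box to each of the first \<open>N - psize \<alpha>\<close>
  columns.\<close>

lemma transp_pad:
  assumes "is_partition \<alpha>"
  shows "transp (pad N \<alpha>) j = (if j < N - psize \<alpha> then 1 else 0) + transp \<alpha> j"
proof -
  have "{i. j < pad N \<alpha> i} = (if j < N - psize \<alpha> then {0} else {}) \<union> Suc ` {i. j < \<alpha> i}"
    (is "?L = ?R")
  proof (rule set_eqI)
    show "i \<in> ?L \<longleftrightarrow> i \<in> ?R" for i by (cases i) (auto simp: pad_def)
  qed
  moreover have "finite {i. j < \<alpha> i}"
    by (rule support_transp(2)[OF assms])
  ultimately show ?thesis
    by (auto simp: transp_def card_image card_insert_if)
qed

text \<open>From index \<open>\<alpha> 0\<close> on, a column holds at most the box of the new row.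
  Each earlier column gains at most one box, hence the extra \<open>\<alpha> 0\<close>.\<close>

lemma long_columns_pad_le:
  assumes "is_partition \<alpha>"
  shows "(\<Sum>j | 1 < transp (pad N \<alpha>) j. transp (pad N \<alpha>) j) \<le> psize \<alpha> + \<alpha> 0"
proof -
  have "{j. 1 < transp (pad N \<alpha>) j} \<subseteq> {..<\<alpha> 0}"
    using support_transp(1)[OF assms]
    by (fastforce simp: transp_pad[OF assms] split: if_splits)
  then have "(\<Sum>j | 1 < transp (pad N \<alpha>) j. transp (pad N \<alpha>) j)
      \<le> (\<Sum>j<\<alpha> 0. transp (pad N \<alpha>) j)"
    by (intro sum_mono2) auto
  also have "\<dots> \<le> (\<Sum>j<\<alpha> 0. 1 + transp \<alpha> j)"
    by (intro sum_mono) (simp add: transp_pad[OF assms])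
  also have "\<dots> = \<alpha> 0 + psize (transp \<alpha>)"
    unfolding psize_def support_transp(1)[OF assms] by (subst sum.distrib) simp
  finally show ?thesis
    using psize_transp[OF assms] by simp
qed

theorem theorem6p3:
  fixes lam mu pi tlam tmu tpi :: "nat \<Rightarrow> nat" and \<iota> :: nat
  assumes "is_partition lam" and "is_partition mu" and "is_partition pi"
    and "psize lam = psize mu + psize pi"
  defines "\<iota> \<equiv> psize lam + lam 0"
  defines "tlam \<equiv> pad (3 * \<iota>) lam"
    and "tmu \<equiv> pad (3 * \<iota>) mu"
    and "tpi \<equiv> pad (3 * \<iota>) pi"
  shows "is_partition tlam \<and> is_partition tmu \<and> is_partition tpi
    \<and> psize tlam = 3 * \<iota> \<and> psize tmu = 3 * \<iota> \<and> psize tpi = 3 * \<iota>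
    \<and> t_num tlam tmu tpi > 0"
proof -
  let ?N = "3 * \<iota>"
  have first: "lam 0 \<le> psize lam" "mu 0 \<le> psize mu" "pi 0 \<le> psize pi"
    using assms(1-3) by (simp_all add: first_part_le_psize)
  have le: "psize lam + lam 0 \<le> ?N" "psize mu + mu 0 \<le> ?N" "psize pi + pi 0 \<le> ?N"
    using assms(4) first by (auto simp: \<iota>_def)
  have part: "is_partition tlam" "is_partition tmu" "is_partition tpi"
    unfolding tlam_def tmu_def tpi_def using assms(1-3) le by (simp_all add: is_partition_pad)
  have size: "psize tlam = ?N" "psize tmu = ?N" "psize tpi = ?N"
    unfolding tlam_def tmu_def tpi_def using assms(1-3) le by (simp_all add: psize_pad)
  have "(\<Sum>j | 1 < transp tlam j. transp tlam j) + (\<Sum>j | 1 < transp tmu j. transp tmu j)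
      \<le> (psize lam + lam 0) + (psize mu + mu 0)"
    unfolding tlam_def tmu_def using assms(1,2) by (intro add_mono long_columns_pad_le)
  \<comment> \<open>Both \<open>psize mu\<close> and \<open>mu 0\<close> are at most
    \<open>psize lam\<close>, so the sum is at most \<open>3 * psize lam + lam 0\<close>.\<close>
  also have "\<dots> \<le> ?N"
    using assms(4) first by (simp add: \<iota>_def)
  finally have "t_num tlam tmu tpi > 0"
    using part size by (intro t_num_pos) (simp_all only: support_transp(1) psize_transp finite_lessThan)
  then show ?thesis using part size by simp
qed

end
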